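(* Let $n$ be a positive integer. Then, modulo $\Phi_n(q)^2$, $$\left(\binom{n}{0}\right)_q\equiv \begin{cases}(-1)^m(1+q^m)q^{m(3m-1)/2}, & \text{if } n=3m,\\ (-1)^m q^{m(3m+1)/2}, & \text{if } n=3m+1,\\ (-1)^m q^{m(3m-1)/2}, & \text{if } n=3m-1,\end{cases}$$ where in each case $m$ is the (non-negative) integer determined by $n$ through the indicated relation.
   Context: Here $q$ is an indeterminate. The $q$-binomial coefficients are ${n\brack k}=\dfrac{(1-q^n)(1-q^{n-1})\cdots(1-q^{n-k+1})}{(1-q)(1-q^2)\cdots(1-q^k)}$ if $0\le k\le n$, and ${n\brack k}=0$ otherwise; they are polynomials in $\mathbb{Z}[q]$. The (Andrews–Baxter) $q$-trinomial coefficients are defined by $$\left(\binom{n}{j}\right)_q=\sum_{k=0}^{n}q^{k(k+j)}{n\brack k}{n-k\brack k+j}.$$ The polynomial $\Phi_n(q)=\prod_{1\le k\le n,\ \gcd(n,k)=1}(q-\zeta^k)$, with $\zeta$ a primitive $n$th root of unity, is the $n$th cyclotomic polynomial. For polynomials $A(q),B(q),P(q)\in\mathbb{Z}[q]$, the congruence $A(q)\equiv B(q)\pmod{P(q)}$ means that $P(q)$ divides $A(q)-B(q)$. *)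

theory Defs
  imports "HOL-Computational_Algebra.Computational_Algebra"
begin

abbreviation qvar :: "int poly" where
  "qvar \<equiv> [:0, 1:]"

text \<open>
  The operator \<open>div\<close> on \<^typ>\<open>int poly\<close> is exact division: it is meaningful only if the
  denominator divides the numerator in \<open>\<int>[q]\<close>, which is \<open>qbinomial_dvd\<close> below.
\<close>

definition qbinomial :: "nat \<Rightarrow> int \<Rightarrow> int poly" where
  "qbinomial n k =
     (if 0 \<le> k \<and> k \<le> int n
      then (\<Prod>i=1..nat k. 1 - qvar ^ (n + 1 - i)) div (\<Prod>i=1..nat k. 1 - qvar ^ i)
      else 0)"

lemma qbinomial_dvd:
  "(\<Prod>i=1..k. 1 - qvar ^ i) dvd (\<Prod>i=1..k. 1 - qvar ^ (n + 1 - i))"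
proof (induction n arbitrary: k)
  case 0
  show ?case
  proof (cases k)
    case (Suc j)
    have "(\<Prod>i=1..k. 1 - qvar ^ (0 + 1 - i)) = 0"
      by (rule prod_zero) (auto simp: Suc intro!: bexI[of _ 1])
    then show ?thesis by (metis dvd_0_right)
  qed simp
next
  case (Suc n)
  let ?D = "\<lambda>k. (\<Prod>i=1..k. 1 - qvar ^ i)"
  let ?N = "\<lambda>n k. (\<Prod>i=1..k. 1 - qvar ^ (n + 1 - i))"
  show ?case
  proof (cases k)
    case k: (Suc j)
    have shift: "?N (Suc n) (Suc j) = (1 - qvar ^ Suc n) * ?N n j"
      by (subst prod.atLeast_Suc_atMost) (simp_all only: prod.shift_bounds_cl_Suc_ivl, simp_all)
    have last: "?N n (Suc j) = ?N n j * (1 - qvar ^ (n - j))"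
      by simp
    show ?thesis
    proof (cases "j \<le> n")
      case True
      have ring: "(1 - a * b) * N = N * (1 - a) + a * (N * (1 - b))" for a b N :: "int poly"
        by (simp add: algebra_simps)
      have pow: "qvar ^ Suc n = qvar ^ (n - j) * qvar ^ Suc j"
        using True by (simp flip: power_add)
      have eq: "?N (Suc n) (Suc j) =
          ?N n (Suc j) + qvar ^ (n - j) * (?N n j * (1 - qvar ^ Suc j))"
        unfolding shift last pow by (rule ring)
      have "?D (Suc j) dvd ?N n j * (1 - qvar ^ Suc j)"
        using Suc.IH[of j] by (simp only: prod.cl_ivl_Suc) (auto intro: mult_dvd_mono)
      then show ?thesis
        unfolding k eq using Suc.IH[of "Suc j"] by (intro dvd_add[OF _ dvd_mult])
    next
      case False
      have "?N n j = 0"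
        by (rule prod_zero) (use False in \<open>auto intro!: bexI[of _ "Suc n"]\<close>)
      then show ?thesis unfolding k shift by (simp only: mult_zero_right dvd_0_right)
    qed
  qed simp
qed

text \<open>
  For \<open>k + j < 0\<close> the exponent is truncated by \<^const>\<open>nat\<close>, but then the second
  \<open>q\<close>-binomial coefficient is \<open>0\<close>.
\<close>

definition qtrinomial :: "nat \<Rightarrow> int \<Rightarrow> int poly" where
  "qtrinomial n j =
     (\<Sum>k=0..n. qvar ^ nat (int k * (int k + j)) * qbinomial n (int k)
                 * qbinomial (n - k) (int k + j))"

definition cyclotomic_complex :: "nat \<Rightarrow> complex poly" where
  "cyclotomic_complex n =
     (\<Prod>k\<in>{k\<in>{1..n}. coprime n k}. [:- (cis (2 * pi / real n) ^ k), 1:])"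

text \<open>
  The same polynomial as an element of \<open>\<int>[q]\<close>; that the coefficients are indeed integers
  is \<open>of_int_cyclotomic\<close> below.
\<close>

definition cyclotomic :: "nat \<Rightarrow> int poly" where
  "cyclotomic n = (THE p. map_poly of_int p = cyclotomic_complex n)"

lemma map_poly_of_int_mult:
  "map_poly of_int (p * q) = (map_poly of_int p * map_poly of_int q :: complex poly)"
  by (rule poly_eqI) (simp add: coeff_map_poly coeff_mult)

lemma map_poly_of_int_diff:
  "map_poly of_int (p - q) = (map_poly of_int p - map_poly of_int q :: complex poly)"
  by (rule poly_eqI) (simp add: coeff_map_poly)

lemma map_poly_of_int_prod:
  "map_poly of_int (\<Prod>x\<in>A. f x) = (\<Prod>x\<in>A. map_poly of_int (f x) :: complex poly)"
  by (induction A rule: infinite_finite_induct) (simp_all add: map_poly_of_int_mult)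

lemma map_poly_of_int_inj:
  "map_poly of_int p = (map_poly of_int q :: complex poly) \<Longrightarrow> p = q"
  by (simp add: poly_eq_iff coeff_map_poly)

lemma monic_quotient_of_int:
  fixes g :: "complex poly"
  assumes "lead_coeff p = 1" and eq: "map_poly of_int p * g = map_poly of_int f"
  shows "\<exists>h. g = map_poly of_int h"
proof -
  obtain h r where hr: "pseudo_divmod f p = (h, r)" by force
  have "p \<noteq> 0" using assms(1) by auto
  from pseudo_divmod[OF this hr] assms(1)
  have f: "f = p * h + r" and r: "r = 0 \<or> degree r < degree p" by auto
  from f have "r = f - p * h" by simp
  then have "map_poly of_int r = map_poly of_int p * (g - map_poly of_int h)"
    by (simp add: map_poly_of_int_diff map_poly_of_int_mult right_diff_distrib eq)
  moreover have "degree (map_poly of_int x :: complex poly) = degree x" for x :: "int poly"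
    by (cases "x = 0") (auto intro: map_poly_degree_eq)
  moreover have "map_poly of_int p \<noteq> (0 :: complex poly)"
    using map_poly_of_int_inj[of p 0] \<open>p \<noteq> 0\<close> by auto
  ultimately have "g - map_poly of_int h = 0"
    using r degree_mult_eq[of "map_poly of_int p" "g - map_poly of_int h"]
    by (metis leD le_add1 map_poly_0 mult_eq_0_iff)
  then show ?thesis by auto
qed

lemma prod_roots_unity:
  assumes "n > 0"
  shows "(\<Prod>k=1..n. [:- (cis (2 * pi / real n) ^ k), 1:]) = (monom 1 n - 1 :: complex poly)"
    (is "?L = ?R")
proof (rule poly_eqI_degree_lead_coeff[where A = "{z. z ^ n = 1}" and n = n])
  have deg: "degree ?L = n"
    by (subst degree_prod_eq_sum_degree) auto
  then show "degree ?L \<le> n" by simp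
  have "lead_coeff ?L = 1"
    by (simp add: lead_coeff_prod)
  then show "coeff ?L n = coeff ?R n"
    using deg assms by (simp add: coeff_1)
  show "degree ?R \<le> n"
    by (intro degree_diff_le) (auto simp: degree_monom_le)
  show "n \<le> card {z::complex. z ^ n = 1}"
    using card_roots_unity_eq[OF assms] by simp
next
  fix z :: complex assume "z \<in> {z. z ^ n = 1}"
  then have z: "z ^ n = 1" by simp
  then obtain k where k: "k < n" "z = cis (2 * pi * real k / real n)"
    using bij_betw_imp_surj_on[OF bij_betw_roots_unity[OF assms]] by blast
  let ?k = "if k = 0 then n else k"
  have "z = cis (2 * pi / real n) ^ ?k"
    using k assms cis_2pi by (auto simp: DeMoivre mult.commute mult.left_commute)
  then have "poly ?L z = 0"
    unfolding poly_prod using k by (intro prod_zero) (auto intro!: bexI[of _ ?k])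
  then show "poly ?L z = poly ?R z"
    using z by (simp add: poly_monom)
qed

lemma prod_cyclotomic_complex:
  assumes "n > 0"
  shows "(\<Prod>d\<in>{d. d dvd n}. cyclotomic_complex d) = monom 1 n - 1"
proof -
  let ?f = "\<lambda>k. [:- (cis (2 * pi / real n) ^ k), 1:]"
  have part: "(\<Prod>k\<in>{k\<in>{1..n}. n div gcd n k = d}. ?f k) = cyclotomic_complex d"
    if "d dvd n" for d
  proof -
    from that obtain e where e: "n = d * e" by blast
    with assms have pos: "d > 0" "e > 0" by auto
    have "(\<Prod>k\<in>{k\<in>{1..d}. coprime d k}. [:- (cis (2 * pi / real d) ^ k), 1:]) =
          (\<Prod>k\<in>{k\<in>{1..n}. n div gcd n k = d}. ?f k)"
    proof (rule prod.reindex_bij_witness[where i = "\<lambda>k. k div e" and j = "\<lambda>k. k * e"])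
      fix k assume "k \<in> {k\<in>{1..n}. n div gcd n k = d}"
      then have k: "1 \<le> k" "k \<le> n" "n div gcd n k = d" by auto
      then have "n = d * gcd n k"
        by (metis dvd_div_mult_self gcd_dvd1)
      with e pos have g: "gcd n k = e" by auto
      then obtain l where l: "k = l * e"
        by (metis dvd_div_mult_self gcd_dvd2)
      show "k div e * e = k" using l by simp
      have "gcd d l * e = e"
        using g unfolding e l by (simp add: gcd_mult_right gcd.commute)
      then show "k div e \<in> {k\<in>{1..d}. coprime d k}"
        using k l pos e by (auto simp: coprime_iff_gcd_eq_1)
    next
      fix k assume "k \<in> {k\<in>{1..d}. coprime d k}"
      then have k: "1 \<le> k" "k \<le> d" "coprime d k" by auto
      show "k * e div e = k" using pos by simp
      have "gcd n (k * e) = e"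
        using k(3) unfolding e by (simp add: gcd_mult_right coprime_iff_gcd_eq_1 gcd.commute)
      then show "k * e \<in> {k\<in>{1..n}. n div gcd n k = d}"
        using k pos e by auto
      show "?f (k * e) = [:- (cis (2 * pi / real d) ^ k), 1:]"
        using pos by (simp add: e DeMoivre field_simps)
    qed
    then show ?thesis by (simp add: cyclotomic_complex_def)
  qed
  have "(\<Prod>k=1..n. ?f k) =
        (\<Prod>d\<in>{d. d dvd n}. \<Prod>k\<in>{k\<in>{1..n}. n div gcd n k = d}. ?f k)"
    using assms by (intro prod.group[symmetric]) (auto simp: div_dvd_iff_mult)
  also have "\<dots> = (\<Prod>d\<in>{d. d dvd n}. cyclotomic_complex d)"
    by (intro prod.cong refl part) simp
  finally show ?thesis using prod_roots_unity[OF assms] by simp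
qed

lemma lead_coeff_cyclotomic_complex: "lead_coeff (cyclotomic_complex n) = 1"
  by (simp add: cyclotomic_complex_def lead_coeff_prod)

lemma cyclotomic_complex_integral: "\<exists>p. map_poly of_int p = cyclotomic_complex n"
proof (induction n rule: less_induct)
  case (less n)
  show ?case
  proof (cases "n = 0")
    case True
    then show ?thesis
      by (intro exI[of _ 1]) (simp add: cyclotomic_complex_def)
  next
    case False
    let ?S = "{d. d dvd n} - {n}"
    have "\<forall>d\<in>?S. \<exists>p. map_poly of_int p = cyclotomic_complex d"
      using less False by (auto dest: dvd_imp_le intro: le_neq_implies_less)
    then obtain P where P: "\<And>d. d \<in> ?S \<Longrightarrow> map_poly of_int (P d) = cyclotomic_complex d"
      by metis
    define p where "p = (\<Prod>d\<in>?S. P d)"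
    have p: "map_poly of_int p = (\<Prod>d\<in>?S. cyclotomic_complex d)"
      unfolding p_def map_poly_of_int_prod by (intro prod.cong) (auto simp: P)
    have "lead_coeff (map_poly of_int p :: complex poly) = 1"
      unfolding p lead_coeff_prod by (simp add: lead_coeff_cyclotomic_complex)
    moreover have "degree (map_poly of_int p :: complex poly) = degree p"
      by (cases "p = 0") (auto intro: map_poly_degree_eq)
    ultimately have monic: "lead_coeff p = 1"
      by (simp add: coeff_map_poly)
    have "cyclotomic_complex n * (\<Prod>d\<in>?S. cyclotomic_complex d) = monom 1 n - 1"
      using False prod_cyclotomic_complex[of n]
        prod.remove[of "{d. d dvd n}" n cyclotomic_complex] by simp
    also have "\<dots> = map_poly of_int (monom 1 n - 1)"
      by (simp add: map_poly_of_int_diff map_poly_monom)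
    finally have "map_poly of_int p * cyclotomic_complex n = map_poly of_int (monom 1 n - 1)"
      by (simp add: p mult.commute)
    from monic_quotient_of_int[OF monic this] show ?thesis by metis
  qed
qed

lemma of_int_cyclotomic: "map_poly of_int (cyclotomic n) = cyclotomic_complex n"
  unfolding cyclotomic_def
  by (rule theI', rule ex_ex1I)
     (use cyclotomic_complex_integral map_poly_of_int_inj in \<open>metis+\<close>)

end

theory Submission
  imports Defs "HOL-Computational_Algebra.Field_as_Ring"
begin

text \<open>
  Write \<open>[n, k]\<close> for the \<open>q\<close>-binomial coefficient and \<open>\<Phi>\<close> for the \<open>n\<close>th cyclotomic polynomial.
  The proof replaces each summand of the \<open>q\<close>-trinomial coefficient by a simpler one modulo
  \<open>\<Phi>\<^sup>2\<close>, and the simplified sum has a closed form in \<open>\<int>[q]\<close>, which is the right-hand side.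

  Put \<open>W(n, k) = (1 - q^n) / (1 - q^(n - k)) * [n - k, k]\<close>. For \<open>0 < k < n\<close> the two polynomials
  \<open>q^(k^2) [n, k] [n - k, k]\<close> and \<open>(-1)^k q^(k choose 2) W(n, k)\<close> agree modulo \<open>\<Phi>\<^sup>2\<close>
  (\<open>cyclotomic_square_dvd_term\<close>). Both contain the factor \<open>(1 - q^n) [n - k, k]\<close>, since
  \<open>(1 - q^k) [n, k] = (1 - q^n) [n - 1, k - 1]\<close>. As \<open>\<Phi>\<close> divides \<open>1 - q^n\<close> and is coprime to
  \<open>1 - q^k\<close> and \<open>1 - q^(n - k)\<close>, it is enough to compare the cofactors modulo \<open>\<Phi>\<close>,
  where \<open>q^n = 1\<close> and \<open>q^(k choose 2) [n - 1, k - 1] = (-1)^(k - 1)\<close>.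

  It remains to evaluate the sum of \<open>(-1)^k q^(k choose 2) W(n, k)\<close> over \<open>k\<close>. This is a finite form
  of Euler's pentagonal number theorem (\<open>sum_lucas_coeff_closed_form\<close>). With \<open>F(n)\<close> the sum of
  \<open>(-1)^k q^(k choose 2) [n - k, k]\<close>, the splitting
  \<open>W(n, k) = [n - k, k] + q^(n - k) [n - k - 1, k - 1]\<close> turns it into
  \<open>F(n) - q^(n - 1) F(n - 2)\<close>. The two \<open>q\<close>-Pascal rules give a recurrence for \<open>F\<close>, from which
  \<open>F(n)\<close> is seen to be \<open>0\<close> or a signed power of \<open>q\<close>, according to \<open>n\<close> modulo \<open>3\<close>.
\<close>

section \<open>Gaussian binomial coefficients with natural indices\<close>

definition gauss :: "nat \<Rightarrow> nat \<Rightarrow> int poly" where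
  "gauss n k = qbinomial n (int k)"

abbreviation qfact :: "nat \<Rightarrow> int poly" where
  "qfact k \<equiv> \<Prod>i=1..k. 1 - qvar ^ i"

abbreviation qfalling :: "nat \<Rightarrow> nat \<Rightarrow> int poly" where
  "qfalling n k \<equiv> \<Prod>i=1..k. 1 - qvar ^ (n + 1 - i)"

lemma one_minus_qvar_power_nonzero:
  assumes "k > 0"
  shows "1 - qvar ^ k \<noteq> 0"
proof
  assume "1 - qvar ^ k = 0"
  then have "poly (1 - qvar ^ k) 0 = 0"
    by simp
  with assms show False
    by (simp add: power_0_left)
qed

lemma qfact_nonzero: "qfact k \<noteq> 0"
  using one_minus_qvar_power_nonzero by (simp del: power_Suc)

lemma gauss_eq_0: "k > n \<Longrightarrow> gauss n k = 0"
  by (simp add: gauss_def qbinomial_def)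

lemma gauss_0_right [simp]: "gauss n 0 = 1"
  by (simp add: gauss_def qbinomial_def)

lemma gauss_mult_qfact: "gauss n k * qfact k = qfalling n k"
proof (cases "k \<le> n")
  case True
  then show ?thesis
    using qbinomial_dvd[of k n] by (simp add: gauss_def qbinomial_def)
next
  case False
  then have "qfalling n k = 0"
    by (intro prod_zero) (auto intro!: bexI[of _ "Suc n"])
  with False show ?thesis
    by (simp add: gauss_eq_0)
qed

lemma qfact_Suc: "qfact (Suc k) = qfact k * (1 - qvar ^ Suc k)"
  by simp

lemma qfalling_Suc_right: "qfalling n (Suc k) = qfalling n k * (1 - qvar ^ (n - k))"
  by simp

lemma qfalling_Suc_left: "qfalling (Suc n) (Suc k) = (1 - qvar ^ Suc n) * qfalling n k"
  by (subst prod.atLeast_Suc_atMost) (simp_all only: prod.shift_bounds_cl_Suc_ivl, simp_all)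

lemma gauss_absorption:
  "(1 - qvar ^ Suc k) * gauss (Suc n) (Suc k) = (1 - qvar ^ Suc n) * gauss n k"
proof -
  have "((1 - qvar ^ Suc k) * gauss (Suc n) (Suc k)) * qfact k = gauss (Suc n) (Suc k) * qfact (Suc k)"
    by (simp only: qfact_Suc ac_simps)
  also have "\<dots> = ((1 - qvar ^ Suc n) * gauss n k) * qfact k"
    by (simp only: gauss_mult_qfact qfalling_Suc_left mult.assoc)
  finally show ?thesis
    using qfact_nonzero[of k] by (simp only: mult_cancel_right simp_thms)
qed

lemma gauss_Suc_right:
  "(1 - qvar ^ Suc k) * gauss n (Suc k) = (1 - qvar ^ (n - k)) * gauss n k"
proof -
  have "((1 - qvar ^ Suc k) * gauss n (Suc k)) * qfact k = gauss n (Suc k) * qfact (Suc k)"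
    by (simp only: qfact_Suc ac_simps)
  also have "\<dots> = ((1 - qvar ^ (n - k)) * gauss n k) * qfact k"
    by (simp only: gauss_mult_qfact qfalling_Suc_right mult.assoc mult.commute[of "qfalling n k"])
  finally show ?thesis
    using qfact_nonzero[of k] by (simp only: mult_cancel_right simp_thms)
qed

text \<open>
  Both Pascal rules come from multiplying by \<open>1 - q^(k + 1)\<close>: every term then is a multiple of
  \<open>[n, k]\<close>, and \<open>1 - q^(n + 1)\<close> can be split in two ways by means of
  \<open>q^(n + 1) = q^(n - k) * q^(k + 1)\<close>.
\<close>

lemma gauss_pascal:
  "gauss (Suc n) (Suc k) = gauss n (Suc k) + qvar ^ (n - k) * gauss n k"
proof (cases "k \<le> n")
  case True
  define a where "a = qvar ^ (n - k)"
  define b where "b = qvar ^ Suc k"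
  have ab: "qvar ^ Suc n = a * b"
    using True by (simp add: a_def b_def flip: power_add power_Suc)
  have "(1 - b) * gauss (Suc n) (Suc k) = (1 - a * b) * gauss n k"
    using gauss_absorption[of k n] unfolding ab b_def[symmetric] .
  also have "\<dots> = (1 - a) * gauss n k + (1 - b) * (a * gauss n k)"
    by (simp add: algebra_simps)
  also have "(1 - a) * gauss n k = (1 - b) * gauss n (Suc k)"
    using gauss_Suc_right[of k n] unfolding a_def b_def by (rule sym)
  finally have "(1 - b) * gauss (Suc n) (Suc k) = (1 - b) * (gauss n (Suc k) + a * gauss n k)"
    by (simp only: distrib_left)
  then show ?thesis
    using one_minus_qvar_power_nonzero[of "Suc k"]
    unfolding a_def b_def mult_cancel_left by blast
qed (simp add: gauss_eq_0)

lemma gauss_pascal':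
  "gauss (Suc n) (Suc k) = qvar ^ Suc k * gauss n (Suc k) + gauss n k"
proof (cases "k \<le> n")
  case True
  define a where "a = qvar ^ (n - k)"
  define b where "b = qvar ^ Suc k"
  have ab: "qvar ^ Suc n = a * b"
    using True by (simp add: a_def b_def flip: power_add power_Suc)
  have "(1 - b) * gauss (Suc n) (Suc k) = (1 - a * b) * gauss n k"
    using gauss_absorption[of k n] unfolding ab b_def[symmetric] .
  also have "\<dots> = b * ((1 - a) * gauss n k) + (1 - b) * gauss n k"
    by (simp add: algebra_simps)
  also have "(1 - a) * gauss n k = (1 - b) * gauss n (Suc k)"
    using gauss_Suc_right[of k n] unfolding a_def b_def by (rule sym)
  finally have "(1 - b) * gauss (Suc n) (Suc k) = (1 - b) * (b * gauss n (Suc k) + gauss n k)"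
    by (simp only: distrib_left mult.left_commute)
  then show ?thesis
    using one_minus_qvar_power_nonzero[of "Suc k"]
    unfolding a_def b_def mult_cancel_left by blast
qed (simp add: gauss_eq_0)

section \<open>The alternating sums and their closed form\<close>

text \<open>
  These are the polynomials \<open>F(n)\<close>. At \<open>q = 1\<close> they satisfy the recurrence
  \<open>F(n + 2) = F(n + 1) - F(n)\<close> of period \<open>6\<close>, which is why the residue of \<open>n\<close> modulo \<open>3\<close> and a sign decide.
\<close>

definition altsum :: "nat \<Rightarrow> int poly" where
  "altsum n = (\<Sum>k\<le>n. (-1) ^ k * qvar ^ (k choose 2) * gauss (n - k) k)"

text \<open>
  If the \<open>k\<close>th summand of \<open>F(n)\<close> is weighted by \<open>x^k\<close>, the Pascal rules relate the values at
  \<open>x\<close> and \<open>x / q\<close>. Here \<open>x = 1 / q\<close>, and the factor \<open>q^n\<close> clears the denominators.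
\<close>

definition altsum_shifted :: "nat \<Rightarrow> int poly" where
  "altsum_shifted n = (\<Sum>k\<le>n. (-1) ^ k * qvar ^ (k choose 2) * qvar ^ (n - k) * gauss (n - k) k)"

lemma choose_two_Suc: "Suc k choose 2 = (k choose 2) + k"
  by (simp add: numeral_2_eq_2)

text \<open>
  The rule \<open>gauss_pascal\<close> splits \<open>[n + 1 - j, j + 1]\<close>. The extra power \<open>q^(n - 2 j)\<close> combines with
  \<open>(j + 1 choose 2) = (j choose 2) + j\<close> to the weight \<open>q^(n - j)\<close>.
\<close>

lemma altsum_Suc_Suc: "altsum (Suc (Suc n)) = altsum (Suc n) - altsum_shifted n"
proof -
  let ?c = "\<lambda>j. (-1) ^ Suc j * qvar ^ (Suc j choose 2) :: int poly"
  have step: "?c j * gauss (Suc n - j) (Suc j) =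
      ?c j * gauss (n - j) (Suc j) - (-1) ^ j * qvar ^ (j choose 2) * qvar ^ (n - j) * gauss (n - j) j"
    if "j \<le> n" for j
  \<comment> \<open>For \<open>2 j > n\<close> the truncated exponent \<open>n - j - j\<close> is wrong, but the coefficient vanishes.\<close>
  proof (cases "j \<le> n - j")
    case True
    then have e: "qvar ^ (Suc j choose 2) * qvar ^ (n - j - j) = qvar ^ (j choose 2) * qvar ^ (n - j)"
      by (simp add: choose_two_Suc flip: power_add)
    have "?c j * gauss (Suc n - j) (Suc j) = ?c j * gauss (n - j) (Suc j)
        + (-1) ^ Suc j * (qvar ^ (Suc j choose 2) * qvar ^ (n - j - j)) * gauss (n - j) j"
      using that by (simp only: Suc_diff_le gauss_pascal distrib_left mult.assoc)
    then show ?thesis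
      unfolding e power_Suc[of "-1" j] by (simp add: mult.assoc del: power_Suc)
  next
    case False
    then show ?thesis
      using that by (simp add: Suc_diff_le gauss_pascal gauss_eq_0)
  qed
  have "altsum (Suc (Suc n)) = 1 + (\<Sum>j\<le>Suc n. ?c j * gauss (Suc n - j) (Suc j))"
    unfolding altsum_def by (subst sum.atMost_Suc_shift) (simp add: binomial_eq_0 del: power_Suc)
  also have "\<dots> = 1 + (\<Sum>j\<le>n. ?c j * gauss (Suc n - j) (Suc j))"
    by (simp add: gauss_eq_0 del: power_Suc)
  also have "\<dots> = 1 + (\<Sum>j\<le>n. ?c j * gauss (n - j) (Suc j)) - altsum_shifted n"
    unfolding altsum_shifted_def by (simp add: step sum_subtractf del: power_Suc)
  also have "1 + (\<Sum>j\<le>n. ?c j * gauss (n - j) (Suc j)) = altsum (Suc n)"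
    unfolding altsum_def by (subst sum.atMost_Suc_shift) (simp add: binomial_eq_0 del: power_Suc)
  finally show ?thesis .
qed

text \<open>
  The other rule, \<open>gauss_pascal'\<close>, puts the extra power \<open>q^(j + 1)\<close> on the first part, where it
  cancels the dependence of the weight \<open>q^(n + 1 - j)\<close> on \<open>j\<close>; so both parts are unweighted sums again.
\<close>

lemma altsum_shifted_Suc_Suc:
  "altsum_shifted (Suc (Suc n)) = qvar ^ (n + 2) * altsum (Suc n) - qvar ^ (n + 1) * altsum n"
proof -
  let ?s = "\<lambda>j. (-1) ^ Suc j :: int poly"
  let ?c = "\<lambda>j. ?s j * qvar ^ (Suc j choose 2) :: int poly"
  have step: "?c j * qvar ^ (Suc n - j) * gauss (Suc n - j) (Suc j) =
      qvar ^ (n + 2) * (?c j * gauss (n - j) (Suc j))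
      - qvar ^ (n + 1) * ((-1) ^ j * qvar ^ (j choose 2) * gauss (n - j) j)"
    if "j \<le> n" for j
  proof -
    have e1: "qvar ^ (Suc n - j) * qvar ^ Suc j = qvar ^ (n + 2)"
      using that by (simp flip: power_add power_Suc)
    have e2: "qvar ^ (Suc j choose 2) * qvar ^ (Suc n - j) = qvar ^ (n + 1) * qvar ^ (j choose 2)"
      using that by (simp add: choose_two_Suc add.commute flip: power_add power_Suc)
    have "?c j * qvar ^ (Suc n - j) * gauss (Suc n - j) (Suc j) =
      (qvar ^ (Suc n - j) * qvar ^ Suc j) * (?c j * gauss (n - j) (Suc j))
      + ?s j * (qvar ^ (Suc j choose 2) * qvar ^ (Suc n - j)) * gauss (n - j) j"
      using that by (simp only: Suc_diff_le gauss_pascal' distrib_left ac_simps)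
    then show ?thesis
      unfolding e1 e2 power_Suc[of "-1" j] by (simp add: ac_simps del: power_Suc)
  qed
  have "altsum_shifted (Suc (Suc n)) =
      qvar ^ (n + 2) + (\<Sum>j\<le>Suc n. ?c j * qvar ^ (Suc n - j) * gauss (Suc n - j) (Suc j))"
    unfolding altsum_shifted_def by (subst sum.atMost_Suc_shift) (simp add: binomial_eq_0 del: power_Suc)
  also have "\<dots> = qvar ^ (n + 2) + (\<Sum>j\<le>n. ?c j * qvar ^ (Suc n - j) * gauss (Suc n - j) (Suc j))"
    by (simp add: gauss_eq_0 del: power_Suc)
  also have "\<dots> = qvar ^ (n + 2) * (1 + (\<Sum>j\<le>n. ?c j * gauss (n - j) (Suc j))) - qvar ^ (n + 1) * altsum n"
    unfolding altsum_def distrib_left mult_1_right sum_distrib_left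
    unfolding add_diff_eq[symmetric] sum_subtractf[symmetric]
    by (intro arg_cong2[where f = "(+)"] sum.cong refl step) simp
  also have "1 + (\<Sum>j\<le>n. ?c j * gauss (n - j) (Suc j)) = altsum (Suc n)"
    unfolding altsum_def by (subst sum.atMost_Suc_shift) (simp add: binomial_eq_0 del: power_Suc)
  finally show ?thesis .
qed

lemma pentagonal_Suc: "Suc m * (3 * Suc m - 1) div 2 = m * (3 * m + 1) div 2 + (2 * m + 1)"
proof -
  have "Suc m * (3 * Suc m - 1) = m * (3 * m + 1) + 2 * (2 * m + 1)"
    by (simp add: algebra_simps)
  then show ?thesis
    by simp
qed

lemma pentagonal_neg:
  fixes m :: nat
  shows "m * (3 * m + 1) div 2 = m * (3 * m - 1) div 2 + m"
proof -
  have "m * (3 * m + 1) = m * (3 * m - 1) + 2 * m"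
    by (cases m) (simp_all add: algebra_simps)
  then show ?thesis
    by simp
qed

text \<open>
  The two recurrences determine \<open>F\<close> and its shifted companion at two consecutive indices from the
  values at the two preceding ones, so the induction carries both sequences at \<open>3 m\<close> and \<open>3 m + 1\<close>.
\<close>

lemma altsum_closed_form_aux:
  "altsum (3 * m) = (-1) ^ m * qvar ^ (m * (3 * m - 1) div 2) \<and>
   altsum (3 * m + 1) = (-1) ^ m * qvar ^ (m * (3 * m + 1) div 2) \<and>
   altsum_shifted (3 * m) = (-1) ^ m * qvar ^ (m * (3 * m + 1) div 2) \<and>
   altsum_shifted (3 * m + 1) = (-1) ^ m * qvar ^ (Suc m * (3 * Suc m - 1) div 2)"
proof (induction m)
  case 0
  show ?case
    by (simp add: altsum_def altsum_shifted_def gauss_eq_0 numeral_2_eq_2)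
next
  case (Suc m)
  define p where "p = m * (3 * m - 1) div 2"
  define s where "s = ((-1) ^ m :: int poly)"
  have p1: "m * (3 * m + 1) div 2 = p + m"
    by (simp only: pentagonal_neg p_def)
  have p2: "Suc m * (3 * Suc m - 1) div 2 = p + 3 * m + 1"
    by (simp only: pentagonal_Suc p1)
  have p3: "Suc m * (3 * Suc m + 1) div 2 = p + 4 * m + 2"
    by (simp only: pentagonal_neg p2)
  have p4: "Suc (Suc m) * (3 * Suc (Suc m) - 1) div 2 = p + 6 * m + 5"
    by (simp only: pentagonal_Suc p3) simp
  note IH = Suc.IH[unfolded p1 p2, folded p_def s_def]
  let ?n = "3 * m"
  have F2: "altsum (?n + 2) = 0"
    using altsum_Suc_Suc[of ?n] IH by simp
  have F3: "altsum (?n + 3) = - s * qvar ^ (p + 3 * m + 1)"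
    using altsum_Suc_Suc[of "?n + 1"] IH F2 by (simp add: numeral_3_eq_3)
  have G2: "altsum_shifted (?n + 2) = s * qvar ^ (?n + 2) * qvar ^ (p + m) - s * qvar ^ (?n + 1) * qvar ^ p"
    using altsum_shifted_Suc_Suc[of ?n] IH by (simp add: ac_simps)
  have G3: "altsum_shifted (?n + 3) = - s * qvar ^ (?n + 2) * qvar ^ (p + m)"
    using altsum_shifted_Suc_Suc[of "?n + 1"] IH F2 by (simp add: ac_simps numeral_3_eq_3)
  have F4: "altsum (?n + 4) = - s * qvar ^ (p + 4 * m + 2)"
    using altsum_Suc_Suc[of "?n + 2"] F3 G2
    by (simp add: eval_nat_numeral power_add ac_simps)
  have G4: "altsum_shifted (?n + 4) = - s * qvar ^ (p + 6 * m + 5)"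
  proof -
    have "altsum_shifted (?n + 4) = qvar ^ (?n + 4) * altsum (?n + 3)"
      using altsum_shifted_Suc_Suc[of "?n + 2"] F2 by (simp add: eval_nat_numeral)
    also have "\<dots> = - s * qvar ^ ((?n + 4) + (p + 3 * m + 1))"
      unfolding F3 power_add by (simp add: ac_simps)
    finally show ?thesis by (simp add: ac_simps)
  qed
  have n: "3 * Suc m = ?n + 3" "?n + 3 + 1 = ?n + 4"
    by simp_all
  have G3': "altsum_shifted (?n + 3) = - s * qvar ^ (p + 4 * m + 2)"
    unfolding G3 mult.assoc power_add[symmetric] by (simp add: ac_simps)
  have s: "(-1) ^ Suc m = - s"
    by (simp add: s_def)
  show ?case
    unfolding p2 p3 p4 s unfolding n F3 F4 G3' G4 by (intro conjI refl)
qed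

lemma altsum_closed_form:
  "altsum (3 * m) = (-1) ^ m * qvar ^ (m * (3 * m - 1) div 2)"
  "altsum (3 * m + 1) = (-1) ^ m * qvar ^ (m * (3 * m + 1) div 2)"
  "altsum (3 * m + 2) = 0"
  using altsum_closed_form_aux[of m] altsum_Suc_Suc[of "3 * m"] by simp_all

section \<open>A finite form of the pentagonal number theorem\<close>

text \<open>
  This is \<open>W(n, k) = (1 - q^n) / (1 - q^(n - k)) * [n - k, k]\<close>, written without division; the quotient
  form is \<open>lucas_coeff_mult\<close>. At \<open>q = 1\<close> it is the coefficient \<open>n / (n - k) * (n - k choose k)\<close>
  of the Lucas polynomials. The case \<open>k = 0\<close> is separate because of truncated subtraction.
\<close>

definition lucas_coeff :: "nat \<Rightarrow> nat \<Rightarrow> int poly" where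
  "lucas_coeff n k = gauss (n - k) k + (if k = 0 then 0 else qvar ^ (n - k) * gauss (n - k - 1) (k - 1))"

lemma lucas_coeff_mult:
  assumes "k < n"
  shows "(1 - qvar ^ (n - k)) * lucas_coeff n k = (1 - qvar ^ n) * gauss (n - k) k"
proof (cases k)
  case (Suc j)
  define a where "a = qvar ^ (n - k)"
  define b where "b = qvar ^ k"
  have ab: "qvar ^ n = a * b"
    using assms by (simp add: a_def b_def flip: power_add)
  have "(1 - b) * gauss (n - k) k = (1 - a) * gauss (n - k - 1) (k - 1)"
    using gauss_absorption[of j "n - k - 1"] assms Suc by (simp add: a_def b_def Suc_diff_Suc del: power_Suc)
  then have "(1 - a) * lucas_coeff n k = (1 - a) * gauss (n - k) k + a * ((1 - b) * gauss (n - k) k)"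
    using Suc by (simp add: lucas_coeff_def a_def algebra_simps)
  also have "\<dots> = (1 - a * b) * gauss (n - k) k"
    by (simp add: algebra_simps)
  finally show ?thesis
    unfolding ab a_def .
qed (simp add: lucas_coeff_def)

text \<open>
  In the second part of \<open>lucas_coeff\<close>, shifting \<open>k\<close> to \<open>j + 1\<close> turns the exponent
  \<open>(k choose 2) + n + 2 - k\<close> into \<open>(j choose 2) + n + 1\<close>, which is again an alternating sum of the
  first kind.
\<close>

lemma sum_lucas_coeff:
  "(\<Sum>k<Suc (Suc n). (-1) ^ k * qvar ^ (k choose 2) * lucas_coeff (Suc (Suc n)) k) =
    altsum (Suc (Suc n)) - qvar ^ Suc n * altsum n"
proof -
  let ?c = "\<lambda>k. (-1) ^ k * qvar ^ (k choose 2) :: int poly"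
  let ?N = "Suc (Suc n)"
  have step: "?c (Suc j) * (qvar ^ (Suc n - j) * gauss (n - j) j) = - (qvar ^ Suc n * (?c j * gauss (n - j) j))"
    if "j \<le> n" for j
  proof -
    have e: "qvar ^ (Suc j choose 2) * qvar ^ (Suc n - j) = qvar ^ (j choose 2) * qvar ^ Suc n"
      using that by (simp add: choose_two_Suc flip: power_add power_Suc)
    have "?c (Suc j) * (qvar ^ (Suc n - j) * gauss (n - j) j) =
        (-1) ^ Suc j * (qvar ^ (Suc j choose 2) * qvar ^ (Suc n - j)) * gauss (n - j) j"
      by (simp only: mult.assoc)
    then show ?thesis
      unfolding e power_Suc[of "-1" j] by (simp add: ac_simps del: power_Suc)
  qed
  have "(\<Sum>k<?N. ?c k * lucas_coeff ?N k) = (\<Sum>k<?N. ?c k * gauss (?N - k) k) +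
      (\<Sum>k<?N. ?c k * (if k = 0 then 0 else qvar ^ (?N - k) * gauss (?N - k - 1) (k - 1)))"
    unfolding lucas_coeff_def distrib_left sum.distrib ..
  also have "(\<Sum>k<?N. ?c k * gauss (?N - k) k) = altsum ?N"
    unfolding altsum_def lessThan_Suc_atMost[symmetric] by (simp add: gauss_eq_0)
  also have "(\<Sum>k<?N. ?c k * (if k = 0 then 0 else qvar ^ (?N - k) * gauss (?N - k - 1) (k - 1))) =
      (\<Sum>j\<le>n. ?c (Suc j) * (qvar ^ (Suc n - j) * gauss (n - j) j))"
    by (subst sum.lessThan_Suc_shift) (simp add: lessThan_Suc_atMost del: power_Suc)
  also have "\<dots> = - (qvar ^ Suc n * altsum n)"
    unfolding altsum_def sum_distrib_left sum_negf[symmetric] by (intro sum.cong refl step) simp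
  finally show ?thesis
    by simp
qed

text \<open>
  For \<open>n = 1\<close> the sum is \<open>F(1) = 1\<close>. For \<open>n \<ge> 2\<close> it is \<open>F(n) - q^(n - 1) F(n - 2)\<close>, and the residue
  of \<open>n\<close> modulo \<open>3\<close> selects two of the three closed forms. Both are nonzero only for \<open>n = 3 m\<close>, which explains the factor \<open>1 + q^m\<close>: the two
  pentagonal numbers \<open>m (3 m - 1) / 2\<close> and \<open>m (3 m + 1) / 2\<close> differ by \<open>m\<close>.
\<close>

lemma sum_lucas_coeff_closed_form:
  "m > 0 \<Longrightarrow> (\<Sum>k<3 * m. (-1) ^ k * qvar ^ (k choose 2) * lucas_coeff (3 * m) k) =
     (-1) ^ m * (1 + qvar ^ m) * qvar ^ (m * (3 * m - 1) div 2)"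
  "(\<Sum>k<3 * m + 1. (-1) ^ k * qvar ^ (k choose 2) * lucas_coeff (3 * m + 1) k) =
     (-1) ^ m * qvar ^ (m * (3 * m + 1) div 2)"
  "m > 0 \<Longrightarrow> (\<Sum>k<3 * m - 1. (-1) ^ k * qvar ^ (k choose 2) * lucas_coeff (3 * m - 1) k) =
     (-1) ^ m * qvar ^ (m * (3 * m - 1) div 2)"
proof -
  define L where "L n = (\<Sum>k<n. (-1) ^ k * qvar ^ (k choose 2) * lucas_coeff n k)" for n
  have L: "L (Suc (Suc n)) = altsum (Suc (Suc n)) - qvar ^ Suc n * altsum n" for n
    unfolding L_def by (rule sum_lucas_coeff)
  note cf = altsum_closed_form
  have one: "L (3 * Suc j) = (-1) ^ Suc j * (1 + qvar ^ Suc j) * qvar ^ (Suc j * (3 * Suc j - 1) div 2)" for j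
  proof -
    define p where "p = j * (3 * j + 1) div 2"
    have "L (3 * Suc j) = altsum (3 * Suc j) - qvar ^ (3 * j + 2) * altsum (3 * j + 1)"
      using L[of "3 * j + 1"] by (simp add: eval_nat_numeral del: power_Suc)
    also have "\<dots> = (-1) ^ Suc j * (qvar ^ (p + (2 * j + 1)) + qvar ^ (3 * j + 2 + p))"
      unfolding cf(1,2) pentagonal_Suc p_def[symmetric] power_add[of _ "3 * j + 2" p]
        power_Suc[of "-1" j]
      by (simp add: algebra_simps del: power_Suc)
    also have "3 * j + 2 + p = Suc j + (p + (2 * j + 1))"
      by simp
    also have "(-1) ^ Suc j * (qvar ^ (p + (2 * j + 1)) + qvar ^ (Suc j + (p + (2 * j + 1)))) =
        (-1) ^ Suc j * (1 + qvar ^ Suc j) * qvar ^ (p + (2 * j + 1))"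
      unfolding power_add[of _ "Suc j"] by (simp only: distrib_left distrib_right mult_1_left mult_1_right mult.assoc)
    finally show ?thesis
      unfolding pentagonal_Suc p_def .
  qed
  have two: "L (3 * m + 1) = (-1) ^ m * qvar ^ (m * (3 * m + 1) div 2)"
  proof (cases m)
    case 0
    then show ?thesis by (simp add: L_def lucas_coeff_def numeral_2_eq_2)
  next
    case (Suc j)
    have "L (3 * m + 1) = altsum (3 * m + 1) - qvar ^ (3 * j + 3) * altsum (3 * j + 2)"
      using L[of "3 * j + 2"] by (simp add: Suc eval_nat_numeral del: power_Suc)
    then show ?thesis by (simp only: cf)
  qed
  have three: "L (3 * Suc j - 1) = (-1) ^ Suc j * qvar ^ (Suc j * (3 * Suc j - 1) div 2)" for j
  proof -
    define p where "p = j * (3 * j - 1) div 2"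
    have "L (3 * Suc j - 1) = altsum (3 * j + 2) - qvar ^ (3 * j + 1) * altsum (3 * j)"
      using L[of "3 * j"] by (simp add: eval_nat_numeral del: power_Suc)
    also have "\<dots> = (-1) ^ Suc j * (qvar ^ (3 * j + 1) * qvar ^ p)"
      unfolding cf p_def by (simp add: ac_simps)
    also have "\<dots> = (-1) ^ Suc j * qvar ^ (Suc j * (3 * Suc j - 1) div 2)"
      unfolding pentagonal_Suc pentagonal_neg p_def[symmetric] power_add[symmetric] by (simp add: ac_simps)
    finally show ?thesis .
  qed
  show "m > 0 \<Longrightarrow> (\<Sum>k<3 * m. (-1) ^ k * qvar ^ (k choose 2) * lucas_coeff (3 * m) k) =
     (-1) ^ m * (1 + qvar ^ m) * qvar ^ (m * (3 * m - 1) div 2)"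
    using one[of "m - 1", unfolded L_def] by simp
  show "(\<Sum>k<3 * m + 1. (-1) ^ k * qvar ^ (k choose 2) * lucas_coeff (3 * m + 1) k) =
     (-1) ^ m * qvar ^ (m * (3 * m + 1) div 2)"
    by (rule two[unfolded L_def])
  show "m > 0 \<Longrightarrow> (\<Sum>k<3 * m - 1. (-1) ^ k * qvar ^ (k choose 2) * lucas_coeff (3 * m - 1) k) =
     (-1) ^ m * qvar ^ (m * (3 * m - 1) div 2)"
    using three[of "m - 1", unfolded L_def] by simp
qed

section \<open>Divisibility by powers of cyclotomic polynomials\<close>

lemma map_poly_of_int_power:
  "map_poly of_int (p ^ e) = (map_poly of_int p ^ e :: complex poly)"
  by (induction e) (simp_all add: map_poly_of_int_mult)

lemma lead_coeff_cyclotomic: "lead_coeff (cyclotomic n) = 1"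
proof -
  have "degree (map_poly of_int (cyclotomic n) :: complex poly) = degree (cyclotomic n)"
    by (cases "cyclotomic n = 0") (auto intro: map_poly_degree_eq)
  then show ?thesis
    using lead_coeff_cyclotomic_complex[of n] by (simp add: coeff_map_poly flip: of_int_cyclotomic)
qed

text \<open>
  Divisibility by a monic polynomial is insensitive to the coefficient ring, so questions about
  \<open>\<Phi>\<close> in \<open>\<int>[q]\<close> can be settled by looking at its complex roots.
\<close>

lemma dvd_of_int_iff:
  assumes "lead_coeff p = 1"
  shows "(map_poly of_int p :: complex poly) dvd map_poly of_int f \<longleftrightarrow> p dvd f"
proof
  assume "(map_poly of_int p :: complex poly) dvd map_poly of_int f"
  then obtain g :: "complex poly" where g: "map_poly of_int p * g = map_poly of_int f"
    by (metis dvdE)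
  then obtain h where "g = map_poly of_int h"
    using monic_quotient_of_int[OF assms] by blast
  with g have "f = p * h"
    by (metis map_poly_of_int_inj map_poly_of_int_mult)
  then show "p dvd f"
    by simp
qed (auto simp: map_poly_of_int_mult elim!: dvdE)

lemma of_int_one_minus_qvar_power:
  "map_poly of_int (1 - qvar ^ k) = (1 - monom 1 k :: complex poly)"
proof -
  have "qvar ^ k = monom 1 k"
    by (simp add: monom_altdef)
  then show ?thesis
    by (simp add: map_poly_of_int_diff map_poly_monom)
qed

lemma cyclotomic_dvd:
  assumes "n > 0"
  shows "cyclotomic n dvd 1 - qvar ^ n"
proof -
  have "cyclotomic_complex n dvd (\<Prod>d\<in>{d. d dvd n}. cyclotomic_complex d)"
    using assms by (intro dvd_prodI) auto
  then have "cyclotomic_complex n dvd 1 - monom 1 n"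
    unfolding prod_cyclotomic_complex[OF assms] by (metis dvd_minus_iff minus_diff_eq)
  then show ?thesis
    using dvd_of_int_iff[OF lead_coeff_cyclotomic]
    by (metis of_int_cyclotomic of_int_one_minus_qvar_power)
qed

lemma cis_power_eq_1D:
  assumes "n > 0" "cis (2 * pi / real n) ^ l = 1"
  shows "n dvd l"
proof -
  have "cos (real l * (2 * pi / real n)) = 1"
    using assms(2) unfolding DeMoivre by (metis cis.sel(1) one_complex.sel(1))
  then obtain i :: int where i: "real l * (2 * pi / real n) = of_int i * 2 * pi"
    using cos_one_2pi_int by blast
  then have "of_int (int l) = (of_int (i * int n) :: real)"
    using assms(1) by (simp add: field_simps)
  then have "int l = i * int n"
    by (simp only: of_int_eq_iff)
  then show ?thesis
    by (metis dvd_triv_right int_dvd_int_iff)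
qed

lemma coprime_cyclotomic_complex:
  assumes "0 < k" "k < n"
  shows "coprime (cyclotomic_complex n) (1 - monom 1 k)"
  unfolding cyclotomic_complex_def
proof (rule prod_coprime_left)
  fix j assume "j \<in> {j \<in> {1..n}. coprime n j}"
  then have j: "coprime n j"
    by simp
  let ?z = "cis (2 * pi / real n) ^ j"
  have "\<not> n dvd j * k"
    using assms j by (simp add: coprime_dvd_mult_right_iff nat_dvd_not_less)
  then have "?z ^ k \<noteq> 1"
    using cis_power_eq_1D[of n "j * k"] assms by (auto simp: power_mult)
  then have "\<not> [:- ?z, 1:] dvd (1 - monom 1 k)"
    by (simp add: dvd_iff_poly_eq_0 poly_monom)
  moreover have "prime_elem [:- ?z, 1:]"
    by (intro irreducible_imp_prime_elem irreducible_linear_field_poly) simp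
  ultimately show "coprime [:- ?z, 1:] (1 - monom 1 k)"
    by (intro prime_elem_imp_coprime)
qed

text \<open>
  The cancellation takes place in \<open>\<complex>[q]\<close>: a primitive \<open>n\<close>th root of unity is not a \<open>k\<close>th root of unity
  for \<open>0 < k < n\<close>, so \<open>1 - q^k\<close> is coprime to \<open>\<Phi>\<close>. In \<open>\<int>[q]\<close> the two need not generate the unit
  ideal: for \<open>n = 2\<close> and \<open>k = 1\<close> they are \<open>q + 1\<close> and \<open>1 - q\<close>, and both take even values at \<open>q = 1\<close>.
\<close>

lemma cyclotomic_power_dvd_cancel:
  assumes "0 < k" "k < n" "cyclotomic n ^ e dvd (1 - qvar ^ k) * f"
  shows "cyclotomic n ^ e dvd f"
proof -
  have monic: "lead_coeff (cyclotomic n ^ e) = 1"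
    by (simp add: lead_coeff_power lead_coeff_cyclotomic)
  have "cyclotomic_complex n ^ e dvd (1 - monom 1 k) * map_poly of_int f"
    using assms(3) unfolding dvd_of_int_iff[OF monic, symmetric]
    by (simp only: map_poly_of_int_power map_poly_of_int_mult of_int_cyclotomic
        of_int_one_minus_qvar_power)
  moreover have "coprime (cyclotomic_complex n ^ e) (1 - monom 1 k)"
    using coprime_cyclotomic_complex[OF assms(1,2)] by simp
  ultimately have "cyclotomic_complex n ^ e dvd map_poly of_int f"
    by (simp add: coprime_dvd_mult_right_iff)
  then show ?thesis
    unfolding dvd_of_int_iff[OF monic, symmetric]
    by (simp only: map_poly_of_int_power of_int_cyclotomic)
qed

lemma cyclotomic_dvd_gauss:
  assumes "Suc k < n"
  shows "cyclotomic n dvd gauss n (Suc k)"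
proof -
  obtain N where N: "n = Suc N"
    using assms by (cases n) auto
  have "cyclotomic n dvd 1 - qvar ^ Suc N"
    using cyclotomic_dvd[of n] N by (simp del: power_Suc)
  then have "cyclotomic n ^ 1 dvd (1 - qvar ^ Suc k) * gauss n (Suc k)"
    unfolding N gauss_absorption power_one_right by (rule dvd_mult2)
  then show ?thesis
    using cyclotomic_power_dvd_cancel[of "Suc k" n 1 "gauss n (Suc k)"] assms
    by (simp only: power_one_right zero_less_Suc simp_thms)
qed

section \<open>The congruence modulo the square of a cyclotomic polynomial\<close>

text \<open>
  Modulo \<open>\<Phi>\<close> the coefficient \<open>[n, k + 1]\<close> vanishes, so the Pascal rule reads
  \<open>q^(k + 1) [n - 1, k + 1] = - [n - 1, k]\<close>, and the claim follows by induction on \<open>k\<close>.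
\<close>

lemma cyclotomic_dvd_gauss_pred:
  assumes "k < n"
  shows "cyclotomic n dvd qvar ^ (Suc k choose 2) * gauss (n - 1) k - (-1) ^ k"
  using assms
proof (induction k)
  case (Suc k)
  let ?B = "gauss (n - 1)"
  have pascal: "gauss n (Suc k) = qvar ^ Suc k * ?B (Suc k) + ?B k"
    using gauss_pascal'[of "n - 1" k] Suc.prems by simp
  have "qvar ^ (Suc (Suc k) choose 2) * ?B (Suc k) - (-1) ^ Suc k =
      qvar ^ (Suc k choose 2) * gauss n (Suc k) - (qvar ^ (Suc k choose 2) * ?B k - (-1) ^ k)"
    unfolding choose_two_Suc[of "Suc k"] pascal power_add power_Suc[of "-1" k]
    by (simp add: algebra_simps del: power_Suc)
  then show ?case
    using Suc cyclotomic_dvd_gauss[of k n] by (simp add: dvd_diff del: power_Suc)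
qed (simp add: numeral_2_eq_2)

text \<open>
  After multiplication by \<open>(1 - q^k) (1 - q^(n - k))\<close> both products equal \<open>(1 - q^n) [n - k, k]\<close> times a
  cofactor, and the cofactors agree modulo \<open>\<Phi>\<close> by \<open>cyclotomic_dvd_gauss_pred\<close>. The last factor
  \<open>1 - q^n\<close> provides one \<open>\<Phi>\<close> and the difference of the cofactors the other.
\<close>

lemma cyclotomic_square_dvd_term:
  assumes "k < n"
  shows "cyclotomic n ^ 2 dvd
    qvar ^ (k * k) * gauss n k * gauss (n - k) k - (-1) ^ k * qvar ^ (k choose 2) * lucas_coeff n k"
    (is "_ dvd ?T")
proof (cases k)
  case (Suc j)
  let ?\<Phi> = "cyclotomic n"
  define a where "a = qvar ^ (n - k)"
  define b where "b = qvar ^ k"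
  define c where "c = qvar ^ (k choose 2)"
  define s where "s = ((-1) ^ j :: int poly)"
  define B where "B = gauss (n - 1) j"
  define R where "R = gauss (n - k) k"
  have ab: "qvar ^ n = a * b"
    using assms by (simp add: a_def b_def flip: power_add)
  have "k * k = (k choose 2) + ((k choose 2) + k)"
    unfolding Suc by (induction j) (simp_all add: choose_two_Suc numeral_2_eq_2)
  then have kk: "qvar ^ (k * k) = c * c * b"
    unfolding c_def b_def by (metis power_add mult.assoc)
  have sign: "(-1) ^ k = - s"
    by (simp add: Suc s_def)
  have n: "Suc (n - 1) = n"
    using assms by simp
  have absorb: "(1 - b) * gauss n k = (1 - a * b) * B"
    using gauss_absorption[of j "n - 1"] unfolding n Suc[symmetric] ab by (simp only: b_def B_def)
  have luc: "(1 - a) * lucas_coeff n k = (1 - a * b) * R"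
    using lucas_coeff_mult[OF assms] unfolding ab by (simp only: a_def R_def)
  \<comment> \<open>With \<open>a b = q^n\<close>, \<open>B = [n - 1, j]\<close> and \<open>c B \<equiv> s\<close>, the difference of the cofactors is
    \<open>c (b (1 - a) c B + s (1 - b))\<close>, which is congruent to \<open>c s (1 - a b)\<close>.\<close>
  have "(1 - b) * ((1 - a) * ?T) = c * c * b * (1 - a) * R * ((1 - b) * gauss n k)
      + s * c * (1 - b) * ((1 - a) * lucas_coeff n k)"
    unfolding kk sign c_def[symmetric] R_def[symmetric] by (simp add: algebra_simps)
  also have "\<dots> = (1 - a * b) * (R * c * (b * (1 - a) * (c * B - s) + s * (1 - a * b)))"
    unfolding absorb luc by (simp add: algebra_simps)
  finally have eq: "(1 - b) * ((1 - a) * ?T) =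
      (1 - a * b) * (R * c * (b * (1 - a) * (c * B - s) + s * (1 - a * b)))" .
  have d1: "?\<Phi> dvd 1 - a * b"
    using cyclotomic_dvd[of n] assms by (simp flip: ab)
  have d2: "?\<Phi> dvd c * B - s"
    using cyclotomic_dvd_gauss_pred[of j n] assms by (simp add: c_def B_def s_def Suc)
  have "?\<Phi> * ?\<Phi> dvd (1 - b) * ((1 - a) * ?T)"
    unfolding eq by (intro mult_dvd_mono d1 dvd_mult dvd_add d2)
  then have "?\<Phi> ^ 2 dvd (1 - qvar ^ k) * ((1 - qvar ^ (n - k)) * ?T)"
    by (simp only: power2_eq_square a_def b_def)
  then have "?\<Phi> ^ 2 dvd (1 - qvar ^ (n - k)) * ?T"
    by (rule cyclotomic_power_dvd_cancel[rotated 2]) (use assms Suc in simp_all)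
  then show ?thesis
    by (rule cyclotomic_power_dvd_cancel[rotated 2]) (use assms Suc in simp_all)
qed (simp add: lucas_coeff_def binomial_eq_0)

lemma qtrinomial_0_eq:
  assumes "n > 0"
  shows "qtrinomial n 0 = (\<Sum>k<n. qvar ^ (k * k) * gauss n k * gauss (n - k) k)"
proof -
  have "qtrinomial n 0 = (\<Sum>k\<le>n. qvar ^ (k * k) * gauss n k * gauss (n - k) k)"
    unfolding qtrinomial_def gauss_def by (simp add: nat_mult_distrib atLeast0AtMost)
  also have "\<dots> = (\<Sum>k<n. qvar ^ (k * k) * gauss n k * gauss (n - k) k)"
    using assms by (simp add: gauss_eq_0 flip: lessThan_Suc_atMost)
  finally show ?thesis .
qed

lemma cyclotomic_square_dvd_qtrinomial:
  assumes "n > 0"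
  shows "cyclotomic n ^ 2 dvd
    qtrinomial n 0 - (\<Sum>k<n. (-1) ^ k * qvar ^ (k choose 2) * lucas_coeff n k)"
  unfolding qtrinomial_0_eq[OF assms] sum_subtractf[symmetric]
  by (intro dvd_sum cyclotomic_square_dvd_term) simp

theorem theorem1p1:
  fixes n :: nat
  assumes "n > 0"
  shows "\<forall>m::nat.
      (n = 3 * m \<longrightarrow>
        cyclotomic n ^ 2 dvd
          qtrinomial n 0 - (-1) ^ m * (1 + qvar ^ m) * qvar ^ (m * (3 * m - 1) div 2)) \<and>
      (n = 3 * m + 1 \<longrightarrow>
        cyclotomic n ^ 2 dvd
          qtrinomial n 0 - (-1) ^ m * qvar ^ (m * (3 * m + 1) div 2)) \<and>
      (int n = 3 * int m - 1 \<longrightarrow>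
        cyclotomic n ^ 2 dvd
          qtrinomial n 0 - (-1) ^ m * qvar ^ (m * (3 * m - 1) div 2))"
proof (intro allI conjI impI)
  note dvd = cyclotomic_square_dvd_qtrinomial[OF assms]
  fix m :: nat
  show "cyclotomic n ^ 2 dvd
      qtrinomial n 0 - (-1) ^ m * (1 + qvar ^ m) * qvar ^ (m * (3 * m - 1) div 2)"
    if n: "n = 3 * m"
  proof -
    have "m > 0" using n assms by simp
    from dvd[unfolded n sum_lucas_coeff_closed_form(1)[OF this]] show ?thesis unfolding n .
  qed
  show "cyclotomic n ^ 2 dvd qtrinomial n 0 - (-1) ^ m * qvar ^ (m * (3 * m + 1) div 2)"
    if n: "n = 3 * m + 1"
    using dvd[unfolded n sum_lucas_coeff_closed_form(2)] unfolding n .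
  show "cyclotomic n ^ 2 dvd qtrinomial n 0 - (-1) ^ m * qvar ^ (m * (3 * m - 1) div 2)"
    if "int n = 3 * int m - 1"
  proof -
    have m: "m > 0" and n: "n = 3 * m - 1" using that by auto
    from dvd[unfolded n sum_lucas_coeff_closed_form(3)[OF m]] show ?thesis unfolding n .
  qed
qed

end
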